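(* Let $\mathcal{R}=\{(r,t)\mid r>0,\ t\in\mathbb{R}\}$, and let $h(r)=r$ or $h(r)=1/r$. Equip $\mathcal{R}$ with the Riemannian metric $g_h=dr^2+\frac{1}{h^2(r)}dt^2$ and the complex structure $J_h$ defined by $J_h\partial_r=h(r)\partial_t$, $J_h(h(r)\partial_t)=-\partial_r$. Then the group ${\rm Isom}(\mathcal{R},J_h,g_h)$ of holomorphic isometries comprises only the mappings of the form $$G(\zeta)=\zeta+il,\qquad \zeta=r+it,\quad l\in\mathbb{R},$$ that is, $(r,t)\mapsto(r,t+l)$; hence it is isomorphic to the additive group $\mathbb{R}$.
   Context: A point $(r,t)\in\mathcal{R}$ is identified with the complex number $\zeta=r+it$. A holomorphic isometry of $(\mathcal{R},J_h,g_h)$ is an isometry of the Riemannian manifold $(\mathcal{R},g_h)$ onto itself which is holomorphic with respect to $J_h$, i.e. whose differential commutes with $J_h$; ${\rm Isom}(\mathcal{R},J_h,g_h)$ is the group of all these under composition. *)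

theory Defs
  imports "HOL-Analysis.Analysis" "HOL-Algebra.Bij"
begin

section \<open>Smooth maps and holomorphic isometries of an open set\<close>

text \<open>
  All manifolds here are open subsets \<open>S\<close> of a Euclidean space \<open>'a\<close>; every tangent space is
  identified with \<open>'a\<close>. A field of bilinear forms is a function \<open>g\<close> with \<open>g p v w\<close> the value at
  the point \<open>p\<close> on the tangent vectors \<open>v\<close>, \<open>w\<close>; a field of endomorphisms is a function \<open>J\<close>
  with \<open>J p v\<close> the image of the tangent vector \<open>v\<close> at \<open>p\<close>.
\<close>

text \<open>
  \<open>Ck_on S n f\<close>: \<open>f\<close> is \<open>n\<close> times continuously differentiable on the open set \<open>S\<close>. On a
  finite-dimensional space it is enough to iterate the derivatives in all constant directions \<open>v\<close>.
\<close>

primrec Ck_on ::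
  "'a::euclidean_space set \<Rightarrow> nat \<Rightarrow> ('a \<Rightarrow> 'b::real_normed_vector) \<Rightarrow> bool" where
  "Ck_on S 0 f \<longleftrightarrow> continuous_on S f"
| "Ck_on S (Suc n) f \<longleftrightarrow>
     (\<forall>p\<in>S. f differentiable (at p)) \<and> (\<forall>v. Ck_on S n (\<lambda>p. frechet_derivative f (at p) v))"

definition smooth_on ::
  "'a::euclidean_space set \<Rightarrow> ('a \<Rightarrow> 'b::real_normed_vector) \<Rightarrow> bool" where
  "smooth_on S f \<longleftrightarrow> (\<forall>n. Ck_on S n f)"

text \<open>
  Self-maps of \<open>S\<close> are elements of \<^term>\<open>Bij S\<close>, i.e. bijections of \<open>S\<close> with the conventional
  value \<^term>\<open>undefined\<close> outside \<open>S\<close>, so that maps agreeing on \<open>S\<close> are equal. As \<open>S\<close> is open,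
  derivatives at points of \<open>S\<close> do not depend on this convention.
\<close>

definition diffeomorphisms :: "'a::euclidean_space set \<Rightarrow> ('a \<Rightarrow> 'a) set" where
  "diffeomorphisms S = {F \<in> Bij S. smooth_on S F \<and> smooth_on S (inv_into S F)}"

definition isometries ::
  "'a::euclidean_space set \<Rightarrow> ('a \<Rightarrow> 'a \<Rightarrow> 'a \<Rightarrow> real) \<Rightarrow> ('a \<Rightarrow> 'a) set" where
  "isometries S g = {F \<in> diffeomorphisms S. \<forall>p\<in>S. \<forall>v w.
     g (F p) (frechet_derivative F (at p) v) (frechet_derivative F (at p) w) = g p v w}"

definition J_holomorphic ::
  "'a::euclidean_space set \<Rightarrow> ('a \<Rightarrow> 'a \<Rightarrow> 'a) \<Rightarrow> ('a \<Rightarrow> 'a) \<Rightarrow> bool" where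
  "J_holomorphic S J F \<longleftrightarrow> (\<forall>p\<in>S. \<forall>v.
     frechet_derivative F (at p) (J p v) = J (F p) (frechet_derivative F (at p) v))"

definition Isom ::
  "'a::euclidean_space set \<Rightarrow> ('a \<Rightarrow> 'a \<Rightarrow> 'a) \<Rightarrow> ('a \<Rightarrow> 'a \<Rightarrow> 'a \<Rightarrow> real) \<Rightarrow> ('a \<Rightarrow> 'a) monoid" where
  "Isom S J g = (BijGroup S)\<lparr>carrier := {F \<in> isometries S g. J_holomorphic S J F}\<rparr>"

abbreviation real_group :: "real monoid" where
  "real_group \<equiv> \<lparr>carrier = UNIV, mult = (+), one = 0\<rparr>"


section \<open>The half-plane with its metric and complex structure\<close>

definition \<R> :: "(real \<times> real) set" where
  "\<R> = {(r, t) | r t. r > 0}"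

definition \<zeta> :: "real \<times> real \<Rightarrow> complex" where
  "\<zeta> = (\<lambda>(r, t). complex_of_real r + \<i> * complex_of_real t)"

definition del_r :: "real \<times> real" where "del_r = (1, 0)"
definition del_t :: "real \<times> real" where "del_t = (0, 1)"

text \<open>For a tangent vector \<open>v\<close>: \<open>dr v = fst v\<close> and \<open>dt v = snd v\<close>.\<close>

definition g_metric ::
  "(real \<Rightarrow> real) \<Rightarrow> real \<times> real \<Rightarrow> real \<times> real \<Rightarrow> real \<times> real \<Rightarrow> real" where
  "g_metric h = (\<lambda>(r, t) v w. fst v * fst w + 1 / (h r)\<^sup>2 * (snd v * snd w))"

text \<open>
  The linear extension of \<open>J del_r = h(r) del_t\<close>, \<open>J (h(r) del_t) = -del_r\<close>, in the frame
  \<open>del_r, h(r) del_t\<close>, in which \<open>v\<close> has the coordinates \<open>fst v\<close> and \<open>snd v / h(r)\<close>.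
\<close>

definition J_struct ::
  "(real \<Rightarrow> real) \<Rightarrow> real \<times> real \<Rightarrow> real \<times> real \<Rightarrow> real \<times> real" where
  "J_struct h = (\<lambda>(r, t) v. fst v *\<^sub>R (h r *\<^sub>R del_t) + (snd v / h r) *\<^sub>R (- del_r))"

lemma J_struct_frame:
  assumes "h r \<noteq> 0"
  shows "linear (J_struct h (r, t))"
    and "J_struct h (r, t) del_r = h r *\<^sub>R del_t"
    and "J_struct h (r, t) (h r *\<^sub>R del_t) = - del_r"
  using assms
  by (auto simp: J_struct_def del_r_def del_t_def linear_iff algebra_simps add_divide_distrib)

end

theory Submission
  imports Defs
begin

text \<open>
  The edge \<open>r = 0\<close> of the half-plane is missing, and the metric detects it. The curve
  \<open>s \<mapsto> (s, t)\<close> with \<open>0 < s \<le> r\<close> has unit speed and length \<open>r\<close>, and it leaves every compact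
  set as \<open>s \<rightarrow> 0\<close>. Its image under an isometry \<open>F\<close> also has length \<open>r\<close> and leaves every compact
  set. Since \<open>|dr| \<le> 1\<close>, the first coordinate of the image has a limit \<open>\<rho>\<close>. If \<open>\<rho>\<close> were
  positive, \<open>h\<close> would be bounded near \<open>\<rho>\<close>, the second coordinate would have a limit too, and the
  image would converge inside the half-plane. So \<open>\<rho> = 0\<close>, whence
  \<open>fst (F (r, t)) \<le> r\<close> (lemma \<open>unit_speed_map_fst_le\<close>). The same bound for the inverse shows that
  \<open>F\<close> preserves \<open>r\<close> (lemma \<open>isometry_preserves_fst\<close>).

  The rest is linear algebra at each point: the differential of \<open>F\<close> keeps the first component of
  every vector, so being isometric it fixes \<open>\<partial>\<^sub>r\<close>, and being \<open>J\<close>-linear it also fixes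
  \<open>J \<partial>\<^sub>r = h(r) \<partial>\<^sub>t\<close>. Hence it is the identity everywhere, and \<open>F\<close> is a translation, necessarily in
  the direction of \<open>t\<close>. Without the condition on \<open>J\<close> the reflections \<open>t \<mapsto> l - t\<close> would remain.

  The lemmas are stated for an arbitrary positive continuous \<open>h\<close>: positivity makes \<open>g\<close> a metric,
  and continuity gives the bound on \<open>h\<close> near \<open>\<rho>\<close>. The two functions \<open>h\<close> of the theorem are thereby
  treated at once, although their geometries differ: for \<open>h(r) = 1/r\<close> the metric \<open>dr\<^sup>2 + r\<^sup>2 dt\<^sup>2\<close> is
  the flat one of the universal cover of the punctured plane, whereas for \<open>h(r) = r\<close> it is curved.
\<close>

section \<open>Smoothness is a local property\<close>

text \<open>
  Elements of \<^term>\<open>Bij S\<close> and inverses formed with \<^term>\<open>inv_into S\<close> have uncontrolled values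
  outside \<open>S\<close>. This lemma allows them to be replaced there by globally defined formulas.
\<close>

lemma Ck_on_cong:
  fixes f g :: "'a::euclidean_space \<Rightarrow> 'b::real_normed_vector"
  assumes "open S" "\<And>p. p \<in> S \<Longrightarrow> f p = g p" "Ck_on S n f"
  shows "Ck_on S n g"
  using assms(2,3)
proof (induction n arbitrary: f g)
  case 0
  then show ?case by (metis Ck_on.simps(1) continuous_on_cong)
next
  case (Suc n)
  have diff: "f differentiable (at p)" if "p \<in> S" for p
    using Suc.prems(2) that by simp
  have der: "frechet_derivative f (at p) = frechet_derivative g (at p)" if "p \<in> S" for p
    using frechet_derivative_transform_within_open[OF diff[OF that] \<open>open S\<close> that] Suc.prems(1)
    by blast
  have "g differentiable (at p)" if p: "p \<in> S" for p
  proof -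
    obtain D where "(f has_derivative D) (at p)"
      using diff[OF p] unfolding differentiable_def by blast
    then have "(g has_derivative D) (at p)"
      by (rule has_derivative_transform_within_open[OF _ \<open>open S\<close> p])
        (rule Suc.prems(1))
    then show ?thesis unfolding differentiable_def by blast
  qed
  moreover have "Ck_on S n (\<lambda>p. frechet_derivative g (at p) v)" for v
    using Suc.IH[of "\<lambda>p. frechet_derivative f (at p) v" "\<lambda>p. frechet_derivative g (at p) v"]
      der Suc.prems(2) by simp
  ultimately show ?case by simp
qed

lemma smooth_on_cong:
  assumes "open S" "\<And>p. p \<in> S \<Longrightarrow> f p = g p" "smooth_on S f"
  shows "smooth_on S g"
  using assms Ck_on_cong unfolding smooth_on_def by metis

lemma Ck_on_const: "Ck_on S n (\<lambda>_. c)"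
  by (induction n arbitrary: c) simp_all

lemma frechet_derivative_translation: "frechet_derivative (\<lambda>p. p + c) (at p) = (\<lambda>v. v)"
proof -
  have "((\<lambda>p. p + c) has_derivative (\<lambda>v. v)) (at p)"
    by (auto intro!: derivative_eq_intros)
  then show ?thesis using frechet_derivative_at by metis
qed

lemma smooth_on_translation: "smooth_on S (\<lambda>p. p + c)"
  unfolding smooth_on_def
proof
  fix n
  show "Ck_on S n (\<lambda>p. p + c)"
  proof (cases n)
    case 0
    then show ?thesis by (auto intro!: continuous_intros)
  next
    case (Suc m)
    then show ?thesis
      by (simp add: frechet_derivative_translation Ck_on_const)
  qed
qed

lemma smooth_on_differentiable:
  assumes "smooth_on S f" "p \<in> S"
  shows "f differentiable (at p)"
proof -
  have "Ck_on S (Suc 0) f" using assms(1) unfolding smooth_on_def by blast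
  then show ?thesis using assms(2) by simp
qed

section \<open>The half-plane\<close>

lemma mem_\<R>_iff: "p \<in> \<R> \<longleftrightarrow> fst p > 0"
  by (cases p) (auto simp: \<R>_def)

lemma \<R>_eq_Times: "\<R> = {0<..} \<times> UNIV"
  by (auto simp: \<R>_def)

lemma open_\<R>: "open \<R>"
  unfolding \<R>_eq_Times by (intro open_Times) auto

lemma convex_\<R>: "convex \<R>"
  unfolding \<R>_eq_Times by (intro convex_Times) (auto intro: convex_real_interval)

lemma g_metric_apply:
  "g_metric h p v w = fst v * fst w + 1 / (h (fst p))\<^sup>2 * (snd v * snd w)"
  by (cases p) (simp add: g_metric_def)

lemma J_struct_apply: "J_struct h p v = (- (snd v / h (fst p)), fst v * h (fst p))"
  by (cases p) (simp add: J_struct_def del_r_def del_t_def)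

section \<open>Isometries preserve the distance to the edge\<close>

text \<open>
  A bounded derivative makes the function Lipschitz, hence uniformly continuous, up to the excluded
  end point; so it extends there.
\<close>

lemma bounded_derivative_imp_limit_at_right:
  fixes f f' :: "real \<Rightarrow> real"
  assumes "0 < d"
    and der: "\<And>s. 0 < s \<Longrightarrow> s < d \<Longrightarrow> (f has_real_derivative f' s) (at s)"
    and bound: "\<And>s. 0 < s \<Longrightarrow> s < d \<Longrightarrow> \<bar>f' s\<bar> \<le> B"
  shows "\<exists>l. (f \<longlongrightarrow> l) (at_right 0)"
proof -
  have B: "0 \<le> B" using bound[of "d/2"] \<open>0 < d\<close> by fastforce
  have "B-lipschitz_on {0<..<d} f"
  proof (rule lipschitz_onI[OF _ B])
    fix x y :: real assume "x \<in> {0<..<d}" "y \<in> {0<..<d}"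
    then show "dist (f x) (f y) \<le> B * dist x y"
      unfolding dist_norm using der bound
      by (intro field_differentiable_bound[where S = "{0<..<d}" and f' = f'])
        (auto intro: has_field_derivative_at_within)
  qed
  then have "uniformly_continuous_on {0<..<d} f"
    by (rule lipschitz_on_uniformly_continuous)
  moreover have "0 \<in> closure {0<..<d}" using \<open>0 < d\<close> by simp
  ultimately obtain l where "(f \<longlongrightarrow> l) (at 0 within {0<..<d})"
    by (rule uniformly_continuous_on_extension_at_closure)
  moreover have "at 0 within {0<..<d} = at_right 0"
    using \<open>0 < d\<close> by (intro at_within_nhd[where S = "{..<d}"]) auto
  ultimately show ?thesis by auto
qed

text \<open>
  The hypothesis that \<open>F\<close> maps \<open>\<partial>\<^sub>r\<close> to unit vectors makes the image of \<open>s \<mapsto> (s, t)\<close> a unit-speed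
  curve; the continuous left inverse \<open>G\<close> prevents that image from converging in the half-plane.
  This part is one-sided: it bounds how far from the edge \<open>F\<close> can move a point, and it is meant to
  be applied both to an isometry and to its inverse.
\<close>

lemma unit_speed_map_fst_le:
  fixes h :: "real \<Rightarrow> real" and F G :: "real \<times> real \<Rightarrow> real \<times> real"
  assumes hpos: "\<And>r. 0 < r \<Longrightarrow> 0 < h r" and hcont: "continuous_on {0<..} h"
    and into: "\<And>p. p \<in> \<R> \<Longrightarrow> F p \<in> \<R>"
    and der: "\<And>p. p \<in> \<R> \<Longrightarrow> (F has_derivative DF p) (at p)"
    and unit: "\<And>p. p \<in> \<R> \<Longrightarrow> g_metric h (F p) (DF p del_r) (DF p del_r) = 1"
    and Ginto: "\<And>p. p \<in> \<R> \<Longrightarrow> G p \<in> \<R>" and Gcont: "continuous_on \<R> G"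
    and GF: "\<And>p. p \<in> \<R> \<Longrightarrow> G (F p) = p"
    and p: "p \<in> \<R>"
  shows "fst (F p) \<le> fst p"
proof -
  obtain r t where rt: "p = (r, t)" and r: "0 < r" using p by (cases p) (auto simp: mem_\<R>_iff)
  define x where "x s = fst (F (s, t))" for s
  define y where "y s = snd (F (s, t))" for s
  define x' where "x' s = fst (DF (s, t) del_r)" for s
  define y' where "y' s = snd (DF (s, t) del_r)" for s
  have inR: "(s, t) \<in> \<R>" if "0 < s" for s using that by (simp add: mem_\<R>_iff)
  have xpos: "0 < x s" if "0 < s" for s
    using into[OF inR[OF that]] by (simp add: mem_\<R>_iff x_def)
  have curve: "((\<lambda>s. F (s, t)) has_vector_derivative DF (s, t) del_r) (at s)" if "0 < s" for s
  proof -
    have "((\<lambda>s. (s, t)) has_derivative (\<lambda>u. (u, 0))) (at s)"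
      by (auto intro!: derivative_eq_intros)
    then have "((\<lambda>s. F (s, t)) has_derivative (\<lambda>u. DF (s, t) (u, 0))) (at s)"
      using has_derivative_compose der[OF inR[OF that]] by blast
    moreover have "DF (s, t) (u, 0) = u *\<^sub>R DF (s, t) del_r" for u
      using linear_scale[OF has_derivative_linear[OF der[OF inR[OF that]]], of u del_r]
      by (simp add: del_r_def)
    ultimately show ?thesis by (simp add: has_vector_derivative_def)
  qed
  have dx: "(x has_real_derivative x' s) (at s)" if "0 < s" for s
    using has_derivative_fst[OF curve[OF that, unfolded has_vector_derivative_def]]
    by (simp add: has_field_derivative_def x_def[abs_def] x'_def mult_commute_abs)
  have dy: "(y has_real_derivative y' s) (at s)" if "0 < s" for s
    using has_derivative_snd[OF curve[OF that, unfolded has_vector_derivative_def]]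
    by (simp add: has_field_derivative_def y_def[abs_def] y'_def mult_commute_abs)
  have speed: "(x' s)\<^sup>2 + (y' s / h (x s))\<^sup>2 = 1" if "0 < s" for s
    using unit[OF inR[OF that]]
    by (simp add: g_metric_apply x'_def y'_def x_def power2_eq_square)
  have x'_le: "\<bar>x' s\<bar> \<le> 1" if "0 < s" for s
    using speed[OF that] zero_le_power2[of "y' s / h (x s)"] unfolding abs_square_le_1[symmetric]
    by linarith
  have y'_le: "\<bar>y' s\<bar> \<le> h (x s)" if "0 < s" for s
  proof -
    have "\<bar>y' s / h (x s)\<bar> \<le> 1"
      using speed[OF that] zero_le_power2[of "x' s"] unfolding abs_square_le_1[symmetric]
      by linarith
    then show ?thesis using hpos[OF xpos[OF that]] by (simp add: field_simps)
  qed

  \<comment> \<open>The image curve has a first coordinate \<open>x\<close> of bounded speed, so \<open>x\<close> converges at the edge.\<close>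
  obtain \<rho> where \<rho>: "(x \<longlongrightarrow> \<rho>) (at_right 0)"
    using bounded_derivative_imp_limit_at_right[of 1 x x' 1] dx x'_le by auto
  have pos_ev: "\<forall>\<^sub>F s in at_right (0::real). 0 < s"
    by (simp add: eventually_at_right_less)
  have "0 \<le> \<rho>"
    using tendsto_lowerbound[OF \<rho> eventually_mono[OF pos_ev]] xpos by (simp add: less_imp_le)
  moreover have "\<not> 0 < \<rho>"
  proof
    assume "0 < \<rho>"
    \<comment> \<open>Any compact neighbourhood of \<open>\<rho>\<close> inside the positive reals would do. On it the bound
      \<open>\<bar>y'\<bar> \<le> h(x)\<close> becomes uniform, so that \<open>y\<close> converges as well.\<close>
    have "continuous_on {\<rho>/2..2*\<rho>} h"
      using hcont by (rule continuous_on_subset) (use \<open>0 < \<rho>\<close> in auto)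
    then have "bounded (h ` {\<rho>/2..2*\<rho>})"
      using compact_continuous_image compact_imp_bounded by blast
    then obtain M where M: "\<forall>u\<in>{\<rho>/2..2*\<rho>}. \<bar>h u\<bar> \<le> M"
      unfolding bounded_iff by auto
    have "\<forall>\<^sub>F s in at_right 0. \<rho>/2 < x s \<and> x s < 2*\<rho>"
      using order_tendstoD(1)[OF \<rho>, of "\<rho>/2"] order_tendstoD(2)[OF \<rho>, of "2*\<rho>"] \<open>0 < \<rho>\<close>
      by (intro eventually_conj) simp_all
    then obtain d where d: "0 < d" "\<And>s. 0 < s \<Longrightarrow> s < d \<Longrightarrow> \<rho>/2 < x s \<and> x s < 2*\<rho>"
      unfolding eventually_at_right_field by blast
    have "\<bar>y' s\<bar> \<le> M" if "0 < s" "s < d" for s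
      using y'_le[OF that(1)] bspec[OF M, of "x s"] d(2)[OF that] by force
    then obtain y0 where y0: "(y \<longlongrightarrow> y0) (at_right 0)"
      using bounded_derivative_imp_limit_at_right[OF d(1), of y y' M] dy by auto
    have lim: "((\<lambda>s. F (s, t)) \<longlongrightarrow> (\<rho>, y0)) (at_right 0)"
      using tendsto_Pair[OF \<rho> y0] by (simp add: x_def y_def)
    \<comment> \<open>Applying \<open>G\<close> to the curve recovers \<open>(s, t)\<close>, which would then converge inside \<open>\<R>\<close>.\<close>
    have "isCont G (\<rho>, y0)"
      using Gcont open_\<R> \<open>0 < \<rho>\<close> by (simp add: continuous_on_eq_continuous_at mem_\<R>_iff)
    then have "((\<lambda>s. G (F (s, t))) \<longlongrightarrow> G (\<rho>, y0)) (at_right 0)"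
      using lim by (rule isCont_tendsto_compose)
    then have "((\<lambda>s. (s, t)) \<longlongrightarrow> G (\<rho>, y0)) (at_right 0)"
      by (rule Lim_transform_eventually) (use pos_ev GF inR in \<open>auto elim: eventually_mono\<close>)
    then have "((\<lambda>s. s) \<longlongrightarrow> fst (G (\<rho>, y0))) (at_right 0)"
      using tendsto_fst by fastforce
    moreover have "((\<lambda>s. s) \<longlongrightarrow> 0) (at_right (0::real))" by simp
    ultimately have "fst (G (\<rho>, y0)) = 0"
      using tendsto_unique trivial_limit_at_right_real by blast
    moreover have "0 < fst (G (\<rho>, y0))"
      using Ginto[of "(\<rho>, y0)"] \<open>0 < \<rho>\<close> by (simp add: mem_\<R>_iff)
    ultimately show False by simp
  qed
  ultimately have "(x \<longlongrightarrow> 0) (at_right 0)" using \<rho> by simp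
  \<comment> \<open>The curve starts at the edge, and \<open>x\<close> grows with speed at most \<open>1\<close>.\<close>
  then have "((\<lambda>s. x s + (r - s)) \<longlongrightarrow> 0 + (r - 0)) (at_right 0)"
    by (intro tendsto_intros)
  moreover have "\<forall>\<^sub>F s in at_right 0. x r \<le> x s + (r - s)"
    unfolding eventually_at_right_field
  proof (intro exI[of _ r] conjI r allI impI)
    fix s assume s: "0 < s" "s < r"
    have "norm (x r - x s) \<le> 1 * norm (r - s)"
      by (rule field_differentiable_bound[where S = "{0<..}" and f' = x'])
        (use dx x'_le s r in \<open>auto intro: has_field_derivative_at_within\<close>)
    then show "x r \<le> x s + (r - s)" using s by (simp add: abs_le_iff)
  qed
  ultimately have "x r \<le> 0 + (r - 0)"
    using tendsto_lowerbound trivial_limit_at_right_real by blast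
  then show ?thesis by (simp add: rt x_def)
qed

text \<open>
  The coordinate \<open>r\<close> is the distance to the missing edge, hence a metric invariant. Formally, the
  one-sided bound holds for \<open>F\<close> and for its inverse, which is isometric by the chain rule.
\<close>

lemma isometry_preserves_fst:
  fixes h :: "real \<Rightarrow> real"
  assumes hpos: "\<And>r. 0 < r \<Longrightarrow> 0 < h r" and hcont: "continuous_on {0<..} h"
    and F: "F \<in> isometries \<R> (g_metric h)" and p: "p \<in> \<R>"
  shows "fst (F p) = fst p"
proof -
  define G where "G = inv_into \<R> F"
  define DF where "DF p = frechet_derivative F (at p)" for p
  define DG where "DG p = frechet_derivative G (at p)" for p
  have bij: "bij_betw F \<R> \<R>" and smooth: "smooth_on \<R> F" "smooth_on \<R> G"
    and iso: "\<And>p v w. p \<in> \<R> \<Longrightarrow> g_metric h (F p) (DF p v) (DF p w) = g_metric h p v w"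
    using F by (auto simp: isometries_def diffeomorphisms_def Bij_def G_def DF_def)
  have into: "F p \<in> \<R>" "G p \<in> \<R>" and inv: "G (F p) = p" "F (G p) = p" if "p \<in> \<R>" for p
    using that bij bij_betw_inv_into[OF bij] unfolding G_def
    by (auto simp: bij_betw_apply bij_betw_inv_into_left bij_betw_inv_into_right)
  have der: "(F has_derivative DF p) (at p)" "(G has_derivative DG p) (at p)" if "p \<in> \<R>" for p
    using smooth_on_differentiable smooth that
    unfolding DF_def DG_def by (auto simp flip: frechet_derivative_works)
  have cont: "continuous_on \<R> F" "continuous_on \<R> G"
    using der by (meson continuous_at_imp_continuous_on has_derivative_continuous)+
  have unit: "g_metric h q del_r del_r = 1" for q
    by (simp add: g_metric_apply del_r_def)
  have isoG: "g_metric h (G p) (DG p v) (DG p w) = g_metric h p v w" if "p \<in> \<R>" for p v w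
  proof -
    have "((\<lambda>q. F (G q)) has_derivative (\<lambda>v. DF (G p) (DG p v))) (at p)"
      using has_derivative_compose[OF der(2)[OF that] der(1)[OF into(2)[OF that]]] .
    then have "((\<lambda>q. q) has_derivative (\<lambda>v. DF (G p) (DG p v))) (at p)"
      by (rule has_derivative_transform_within_open[OF _ open_\<R> that]) (rule inv(2))
    then have "(\<lambda>v. DF (G p) (DG p v)) = (\<lambda>v. v)"
      using has_derivative_unique has_derivative_ident by blast
    then have "DF (G p) (DG p v) = v" for v by meson
    then show ?thesis using iso[OF into(2)[OF that], of "DG p v" "DG p w"] inv(2)[OF that] by simp
  qed
  have "fst (F p) \<le> fst p"
    by (rule unit_speed_map_fst_le[where h = h and DF = DF and G = G])
      (use hpos hcont into der cont inv iso unit p in auto)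
  moreover have "fst (G (F p)) \<le> fst (F p)"
    by (rule unit_speed_map_fst_le[where h = h and DF = DG and G = F])
      (use hpos hcont into der cont inv isoG unit p in auto)
  ultimately show ?thesis using inv(1)[OF p] by simp
qed

section \<open>Holomorphic isometries are the translations along the edge\<close>

text \<open>
  Since \<open>F\<close> preserves \<open>r\<close>, its differential \<open>D\<close> preserves \<open>dr\<close>. As \<open>D \<partial>\<^sub>r\<close> is a unit vector whose
  \<open>r\<close>-component is already \<open>1\<close>, it equals \<open>\<partial>\<^sub>r\<close>. Isometry alone leaves the sign of \<open>D \<partial>\<^sub>t\<close>
  open; the commutation with \<open>J\<close> decides it, since \<open>J \<partial>\<^sub>r = h(r) \<partial>\<^sub>t\<close> at \<open>p\<close> and, because \<open>F\<close>
  preserves \<open>r\<close>, with the same factor at \<open>F p\<close>.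
\<close>

lemma holomorphic_isometry_frechet_derivative:
  fixes h :: "real \<Rightarrow> real"
  assumes hpos: "\<And>r. 0 < r \<Longrightarrow> 0 < h r" and hcont: "continuous_on {0<..} h"
    and F: "F \<in> isometries \<R> (g_metric h)" and J: "J_holomorphic \<R> (J_struct h) F"
    and p: "p \<in> \<R>"
  shows "frechet_derivative F (at p) v = v"
proof -
  let ?D = "frechet_derivative F (at p)"
  have "smooth_on \<R> F" using F by (simp add: isometries_def diffeomorphisms_def)
  then have der: "(F has_derivative ?D) (at p)"
    using smooth_on_differentiable[OF _ p] frechet_derivative_works by blast
  have fst_F: "fst (F q) = fst q" if "q \<in> \<R>" for q
    using isometry_preserves_fst[OF hpos hcont F that] .
  have h: "0 < h (fst p)" using p hpos by (simp add: mem_\<R>_iff)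
  have "(fst has_derivative (\<lambda>v. fst (?D v))) (at p)"
    using has_derivative_fst[OF der]
    by (rule has_derivative_transform_within_open[OF _ open_\<R> p]) (rule fst_F)
  moreover have "(fst has_derivative (\<lambda>v. fst v)) (at p)"
    by (intro has_derivative_fst has_derivative_ident)
  ultimately have "(\<lambda>v. fst (?D v)) = (\<lambda>v. fst v)"
    by (rule has_derivative_unique)
  then have fst_D: "fst (?D v) = fst v" for v by meson
  have "g_metric h (F p) (?D del_r) (?D del_r) = g_metric h p del_r del_r"
    using F p unfolding isometries_def by blast
  then have "snd (?D del_r) = 0"
    using h by (simp add: g_metric_apply fst_D fst_F[OF p] del_r_def)
  then have D_r: "?D del_r = del_r"
    using fst_D[of del_r] by (simp add: prod_eq_iff del_r_def)
  have J_r: "J_struct h q del_r = h (fst q) *\<^sub>R del_t" for q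
    by (simp add: J_struct_apply del_r_def del_t_def)
  have "?D (J_struct h p del_r) = J_struct h (F p) (?D del_r)"
    using J p unfolding J_holomorphic_def by blast
  then have "?D (h (fst p) *\<^sub>R del_t) = h (fst p) *\<^sub>R del_t"
    by (simp only: D_r J_r fst_F[OF p])
  then have D_t: "?D del_t = del_t"
    using h by (simp add: linear_scale[OF has_derivative_linear[OF der]])
  have "v = fst v *\<^sub>R del_r + snd v *\<^sub>R del_t"
    by (simp add: prod_eq_iff del_r_def del_t_def)
  then show ?thesis
    using linear_add[OF has_derivative_linear[OF der]]
      linear_scale[OF has_derivative_linear[OF der]] D_r D_t by metis
qed

definition t_translation :: "real \<Rightarrow> real \<times> real \<Rightarrow> real \<times> real" where
  "t_translation l = (\<lambda>(r, t)\<in>\<R>. (r, t + l))"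

lemma t_translation_apply: "p \<in> \<R> \<Longrightarrow> t_translation l p = p + (0, l)"
  by (cases p) (simp add: t_translation_def)

lemma t_translation_mem: "p \<in> \<R> \<Longrightarrow> t_translation l p \<in> \<R>"
  by (simp add: t_translation_apply mem_\<R>_iff)

text \<open>
  On the convex set \<open>\<R>\<close> the map \<open>F - id\<close> has derivative zero, so it is constant, and the constant
  has first component zero because \<open>F\<close> preserves \<open>r\<close>.
\<close>

lemma holomorphic_isometry_imp_t_translation:
  fixes h :: "real \<Rightarrow> real"
  assumes hpos: "\<And>r. 0 < r \<Longrightarrow> 0 < h r" and hcont: "continuous_on {0<..} h"
    and F: "F \<in> isometries \<R> (g_metric h)" and J: "J_holomorphic \<R> (J_struct h) F"
  shows "\<exists>l. F = t_translation l"
proof -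
  have smooth: "smooth_on \<R> F" and ext: "F \<in> extensional \<R>"
    using F by (simp_all add: isometries_def diffeomorphisms_def Bij_def)
  have "((\<lambda>q. F q - q) has_derivative (\<lambda>v. 0)) (at p within \<R>)" if "p \<in> \<R>" for p
  proof -
    have "(F has_derivative frechet_derivative F (at p)) (at p)"
      using smooth_on_differentiable[OF smooth that] frechet_derivative_works by blast
    moreover have "frechet_derivative F (at p) = (\<lambda>v. v)"
      using holomorphic_isometry_frechet_derivative[OF hpos hcont F J that] by blast
    ultimately have "(F has_derivative (\<lambda>v. v)) (at p)" by simp
    from has_derivative_diff[OF this has_derivative_ident] show ?thesis by (simp add: has_derivative_at_withinI)
  qed
  from has_derivative_zero_constant[OF convex_\<R> this]
  obtain c where c: "\<And>p. p \<in> \<R> \<Longrightarrow> F p - p = c" by auto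
  have one: "(1, 0) \<in> \<R>" by (simp add: mem_\<R>_iff)
  have "fst c = 0"
    using isometry_preserves_fst[OF hpos hcont F one] c[OF one] by auto
  then have "c = (0, snd c)" by (simp add: prod_eq_iff)
  then have "F p = t_translation (snd c) p" if "p \<in> \<R>" for p
    using c[OF that] that by (metis t_translation_apply diff_eq_eq add.commute)
  then have "F = t_translation (snd c)"
    using ext by (intro extensionalityI[of _ \<R>]) (auto simp: t_translation_def)
  then show ?thesis by blast
qed

lemma t_translation_in_Bij: "t_translation l \<in> Bij \<R>"
proof -
  have "bij_betw (t_translation l) \<R> \<R>"
    by (rule bij_betw_byWitness[where f' = "t_translation (- l)"])
      (auto simp: t_translation_mem, auto simp: t_translation_apply mem_\<R>_iff prod_eq_iff)
  then show ?thesis by (simp add: Bij_def t_translation_def)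
qed

lemma inv_into_t_translation:
  assumes "p \<in> \<R>"
  shows "inv_into \<R> (t_translation l) p = p + (0, - l)"
proof (rule inv_into_f_eq)
  show "inj_on (t_translation l) \<R>"
    using t_translation_in_Bij[of l] by (simp add: Bij_def bij_betw_def)
  show "p + (0, - l) \<in> \<R>" using assms by (simp add: mem_\<R>_iff)
  then show "t_translation l (p + (0, - l)) = p"
    by (simp add: t_translation_apply prod_eq_iff)
qed

text \<open>
  A translation in \<open>t\<close> has the identity as differential, and \<open>g\<close> and \<open>J\<close> depend on the point only
  through \<open>r\<close>.
\<close>

lemma t_translation_holomorphic_isometry:
  shows "t_translation l \<in> isometries \<R> (g_metric h)"
    and "J_holomorphic \<R> (J_struct h) (t_translation l)"
proof -
  have "smooth_on \<R> (t_translation l)"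
    by (rule smooth_on_cong[OF open_\<R> _ smooth_on_translation[of _ "(0, l)"]])
      (simp add: t_translation_apply)
  moreover have "smooth_on \<R> (inv_into \<R> (t_translation l))"
    by (rule smooth_on_cong[OF open_\<R> _ smooth_on_translation[of _ "(0, - l)"]])
      (simp add: inv_into_t_translation)
  moreover have der: "frechet_derivative (t_translation l) (at p) v = v" if "p \<in> \<R>" for p v
  proof -
    have "frechet_derivative (\<lambda>p. p + (0, l)) (at p) = frechet_derivative (t_translation l) (at p)"
      by (rule frechet_derivative_transform_within_open[OF _ open_\<R> that])
        (simp_all add: t_translation_apply)
    then show ?thesis by (metis frechet_derivative_translation)
  qed
  ultimately show "t_translation l \<in> isometries \<R> (g_metric h)"
    using t_translation_in_Bij
    by (simp add: isometries_def diffeomorphisms_def g_metric_apply t_translation_apply)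
  show "J_holomorphic \<R> (J_struct h) (t_translation l)"
    by (simp add: J_holomorphic_def der J_struct_apply t_translation_apply)
qed

lemma carrier_Isom:
  fixes h :: "real \<Rightarrow> real"
  assumes "\<And>r. 0 < r \<Longrightarrow> 0 < h r" "continuous_on {0<..} h"
  shows "carrier (Isom \<R> (J_struct h) (g_metric h)) = range t_translation"
proof -
  have "F \<in> range t_translation"
    if "F \<in> isometries \<R> (g_metric h)" "J_holomorphic \<R> (J_struct h) F" for F
    using holomorphic_isometry_imp_t_translation[OF assms that] by blast
  then show ?thesis
    unfolding Isom_def using t_translation_holomorphic_isometry by auto
qed

lemma t_translation_iso:
  fixes h :: "real \<Rightarrow> real"
  assumes "\<And>r. 0 < r \<Longrightarrow> 0 < h r" "continuous_on {0<..} h"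
  shows "t_translation \<in> iso real_group (Isom \<R> (J_struct h) (g_metric h))"
proof -
  have "compose \<R> (t_translation l) (t_translation m) = t_translation (l + m)" for l m
  proof (rule extensionalityI[of _ \<R>])
    show "t_translation (l + m) \<in> extensional \<R>" by (simp add: t_translation_def)
    fix p assume "p \<in> \<R>"
    then show "compose \<R> (t_translation l) (t_translation m) p = t_translation (l + m) p"
      by (simp add: compose_eq t_translation_apply mem_\<R>_iff)
  qed (rule compose_extensional)
  then have mult: "t_translation l \<otimes>\<^bsub>Isom \<R> (J_struct h) (g_metric h)\<^esub> t_translation m
      = t_translation (l + m)" for l m
    using t_translation_in_Bij by (simp add: Isom_def BijGroup_def)
  have "t_translation \<in> hom real_group (Isom \<R> (J_struct h) (g_metric h))"
    by (rule homI) (simp_all add: carrier_Isom[OF assms] mult)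
  moreover have "inj t_translation"
  proof (rule injI)
    fix l m assume "t_translation l = t_translation m"
    then have "t_translation l (1, 0) = t_translation m (1, 0)" by simp
    then show "l = m" by (simp add: t_translation_apply mem_\<R>_iff)
  qed
  ultimately show ?thesis by (simp add: iso_def bij_betw_def carrier_Isom[OF assms])
qed

theorem theorem2p1:
  fixes h :: "real \<Rightarrow> real"
  assumes "(\<forall>r>0. h r = r) \<or> (\<forall>r>0. h r = 1 / r)"
  shows "group (Isom \<R> (J_struct h) (g_metric h))
    \<and> carrier (Isom \<R> (J_struct h) (g_metric h))
        = {G \<in> extensional \<R>. \<exists>l::real. \<forall>p\<in>\<R>. \<zeta> (G p) = \<zeta> p + \<i> * complex_of_real l}
    \<and> carrier (Isom \<R> (J_struct h) (g_metric h))
        = {(\<lambda>(r, t)\<in>\<R>. (r, t + l)) | l::real. True}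
    \<and> Isom \<R> (J_struct h) (g_metric h) \<cong> real_group"
proof (intro conjI)
  have hpos: "0 < h r" if "0 < r" for r using assms that by auto
  have "continuous_on {0<..} (\<lambda>r::real. r)" "continuous_on {0<..} (\<lambda>r::real. 1 / r)"
    by (auto intro!: continuous_intros)
  then have hcont: "continuous_on {0<..} h"
    using assms by (metis (no_types, lifting) continuous_on_cong greaterThan_iff)
  have carrier: "carrier (Isom \<R> (J_struct h) (g_metric h)) = range t_translation"
    using hpos hcont by (rule carrier_Isom)
  have iso: "t_translation \<in> iso real_group (Isom \<R> (J_struct h) (g_metric h))"
    using hpos hcont by (rule t_translation_iso)
  interpret real: group real_group
  proof (rule groupI)
    fix x :: real
    show "\<exists>y\<in>carrier real_group. y \<otimes>\<^bsub>real_group\<^esub> x = \<one>\<^bsub>real_group\<^esub>"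
      by (rule bexI[of _ "- x"]) simp_all
  qed simp_all
  have one: "one (Isom \<R> (J_struct h) (g_metric h)) = t_translation 0"
    by (auto simp: Isom_def BijGroup_def t_translation_def restrict_def)
  \<comment> \<open>The group structure is carried over from the reals along the isomorphism.\<close>
  then show "group (Isom \<R> (J_struct h) (g_metric h))"
    using real.iso_imp_img_group[OF iso] by (simp flip: one)
  show "Isom \<R> (J_struct h) (g_metric h) \<cong> real_group"
    using real.iso_sym[OF is_isoI[OF iso]] .
  show "carrier (Isom \<R> (J_struct h) (g_metric h))
      = {(\<lambda>(r, t)\<in>\<R>. (r, t + l)) | l::real. True}"
    unfolding carrier by (simp add: t_translation_def full_SetCompr_eq)
  have \<zeta>_iff: "\<zeta> q = \<zeta> p + \<i> * complex_of_real l \<longleftrightarrow> q = p + (0, l)" for p q l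
    by (cases p; cases q) (auto simp: \<zeta>_def complex_eq_iff)
  have "G \<in> extensional \<R> \<and> (\<forall>p\<in>\<R>. G p = p + (0, l)) \<longleftrightarrow> G = t_translation l" for G l
  proof
    assume "G \<in> extensional \<R> \<and> (\<forall>p\<in>\<R>. G p = p + (0, l))"
    then show "G = t_translation l"
      by (intro extensionalityI[of _ \<R>]) (auto simp: t_translation_def)
  next
    assume "G = t_translation l"
    then show "G \<in> extensional \<R> \<and> (\<forall>p\<in>\<R>. G p = p + (0, l))"
      by (simp add: t_translation_apply) (simp add: t_translation_def)
  qed
  then show "carrier (Isom \<R> (J_struct h) (g_metric h))
      = {G \<in> extensional \<R>. \<exists>l::real. \<forall>p\<in>\<R>. \<zeta> (G p) = \<zeta> p + \<i> * complex_of_real l}"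
    unfolding carrier \<zeta>_iff by blast
qed

end
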